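(* Assume that in the Cauchy problem $\frac{dw}{dt}+A(t)w=\phi(t)$, $t>0$, $w(0)=u^0$, the $m\times m$ matrix $A=[a_{ij}]$, with non-negative diagonal elements, satisfies the condition of weak diagonal dominance by rows $$a_{ii}\ge\sum_{j\ne i}|a_{ij}|,\quad i=1,\dots,m$$ (or by columns, $a_{ii}\ge\sum_{j\ne i}|a_{ji}|$, $i=1,\dots,m$). Then the difference scheme with weights $$\frac{y^{n+1}-y^n}\tau+A(\sigma y^{n+1}+(1-\sigma)y^n)=\varphi^n,\qquad y^0=u^0,$$ is unconditionally stable for $\sigma=1$, and it is conditionally stable for $\sigma<1$, in $L_\infty$ (respectively, in $L_1$) if and only if $$\tau\le\frac1{1-\sigma}\Big(\max_{1\le i\le m}a_{ii}\Big)^{-1}.$$ In this case, the difference solution satisfies the a priori estimate $$\|y^{n+1}\|\le\|u^0\|+\sum_{k=0}^n\tau\|\varphi^k\|$$ in the norm $\|\cdot\|=\|\cdot\|_\infty$ (respectively, $\|\cdot\|=\|\cdot\|_1$). (The time-step condition concerns the case $\sigma<1$; for $\sigma=1$ there is no restriction on $\tau$.)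
   Context: For $w=\{w_1,\dots,w_m\}$: $\|w\|_\infty=\max_{1\le i\le m}|w_i|$ (the norm of $L_\infty$) and $\|w\|_1=\sum_{i=1}^m|w_i|$ (the norm of $L_1$). $\tau>0$ is the time step, $t^n=n\tau$, $y^n$ is the approximate solution at the time level $t^n$, $\sigma$ is the weight, $\varphi^n\in\mathbb R^m$ is the given right-hand side, and in the step from $t^n$ to $t^{n+1}$ the matrix is, e.g., $A=A(\sigma t^{n+1}+(1-\sigma)t^n)$. A two-level scheme is called stable if there exist positive constants $m_1,m_2$, independent of $\tau$, $u^0$ and $\varphi$, such that $\|y^{n+1}\|\le m_1\|u^0\|+m_2\max_{0\le\theta\le t^n}\|\varphi(\theta)\|_*$ for all time levels of the grid $t^n=n\tau$, $n=0,1,\dots,N_0-1$, $\tau N_0=T$, where $\|\cdot\|,\|\cdot\|_*$ are some norms; unconditionally stable means stable for any $\tau>0$, conditionally stable means stable under a restriction on $\tau$.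
   Formalization: "Only if" is false for a single A (m=1, σ=0: |1-τa|≤1 up to τ=2/a); it is proved for m≥2 over the class of all dominant A(t), with constants uniform in A, and for the a priori estimate at given τ, max a_ii=d, τN_0=T. Also σ≥0 is assumed (fails for σ=-1). *)

theory Defs
  imports "HOL-Analysis.Analysis"
begin

text \<open>The norm of \<open>L\<^sub>\<infinity>\<close> is the library's \<^const>\<open>infnorm\<close>: on \<open>real ^ 'm\<close> it is the maximum
  of the absolute values of the components.\<close>

definition L1_norm :: "real ^ 'm \<Rightarrow> real"
  where "L1_norm w = (\<Sum>i\<in>UNIV. \<bar>w $ i\<bar>)"

definition row_dominant :: "real ^ 'm ^ 'm \<Rightarrow> bool"
  where "row_dominant M \<longleftrightarrow> (\<forall>i. 0 \<le> M $ i $ i \<and> (\<Sum>j\<in>UNIV - {i}. \<bar>M $ i $ j\<bar>) \<le> M $ i $ i)"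

definition column_dominant :: "real ^ 'm ^ 'm \<Rightarrow> bool"
  where "column_dominant M \<longleftrightarrow> (\<forall>i. 0 \<le> M $ i $ i \<and> (\<Sum>j\<in>UNIV - {i}. \<bar>M $ j $ i\<bar>) \<le> M $ i $ i)"

definition max_diag :: "real ^ 'm ^ 'm \<Rightarrow> real"
  where "max_diag M = Max (range (\<lambda>i. M $ i $ i))"

definition dominant_family ::
    "(real ^ 'm ^ 'm \<Rightarrow> bool) \<Rightarrow> real \<Rightarrow> (real \<Rightarrow> real ^ 'm ^ 'm) set"
  where "dominant_family dominant T = {A. \<forall>t\<in>{0..T}. dominant (A t)}"

text \<open>A dominant matrix with \<open>max_diag M = 0\<close> is the zero matrix, for which the restriction
  \<open>\<tau> \<le> \<kappa> / max_diag M\<close> is read as void (the bound is infinite); hence the guard,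
  since \<open>inverse 0 = 0\<close> here.\<close>

definition step_restriction ::
    "real \<Rightarrow> real \<Rightarrow> (real \<Rightarrow> real ^ 'm ^ 'm) \<Rightarrow> real \<Rightarrow> bool"
  where "step_restriction \<kappa> T A \<tau> \<longleftrightarrow>
    (\<forall>t\<in>{0..T}. 0 < max_diag (A t) \<longrightarrow> \<tau> \<le> \<kappa> * inverse (max_diag (A t)))"

definition weighted_scheme ::
    "real \<Rightarrow> (real \<Rightarrow> real ^ 'm ^ 'm) \<Rightarrow> real \<Rightarrow> nat \<Rightarrow> real ^ 'm \<Rightarrow>
      (nat \<Rightarrow> real ^ 'm) \<Rightarrow> (nat \<Rightarrow> real ^ 'm) \<Rightarrow> bool"
  where "weighted_scheme \<sigma> A \<tau> N0 u0 \<phi> y \<longleftrightarrow>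
    y 0 = u0 \<and>
    (\<forall>n<N0. (1 / \<tau>) *\<^sub>R (y (Suc n) - y n)
        + A (\<sigma> * (real (Suc n) * \<tau>) + (1 - \<sigma>) * (real n * \<tau>))
            *v (\<sigma> *\<^sub>R y (Suc n) + (1 - \<sigma>) *\<^sub>R y n)
      = \<phi> n)"

text \<open>Stability on the time interval \<open>[0, T]\<close>. The set \<open>P\<close> collects the problems and time steps
  under consideration, and the constants are uniform over it. For a single problem \<open>A\<close>,
  \<open>P = {A} \<times> {0<..}\<close> is unconditional stability and \<open>P = {A} \<times> R\<close> is stability under the
  restriction \<open>\<tau> \<in> R\<close>. With \<open>P\<close> ranging over a family of problems the constants do not
  depend on the member of the family either. This is what makes a time-step restriction
  necessary: for one fixed bounded \<open>A\<close>, \<open>\<sigma> = 0\<close> and \<open>\<tau> \<le> \<tau>0\<close>, some constant of the size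
  of \<open>exp (C * T)\<close> always works, whatever \<open>\<tau>0\<close> is.\<close>

definition two_level_stable ::
    "(real ^ 'm \<Rightarrow> real) \<Rightarrow> real \<Rightarrow> real \<Rightarrow> ((real \<Rightarrow> real ^ 'm ^ 'm) \<times> real) set \<Rightarrow> bool"
  where "two_level_stable nrm \<sigma> T P \<longleftrightarrow>
    (\<exists>m1>0. \<exists>m2>0. \<forall>(A, \<tau>)\<in>P. \<forall>N0 u0 \<phi> y.
      0 < \<tau> \<and> \<tau> * real N0 = T \<and> weighted_scheme \<sigma> A \<tau> N0 u0 \<phi> y \<longrightarrow>
      (\<forall>n<N0. nrm (y (Suc n)) \<le> m1 * nrm u0 + m2 * Max ((\<lambda>k. nrm (\<phi> k)) ` {..n})))"

definition a_priori_estimate ::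
    "(real ^ 'm \<Rightarrow> real) \<Rightarrow> real \<Rightarrow> real \<Rightarrow> (real \<Rightarrow> real ^ 'm ^ 'm) \<Rightarrow> real \<Rightarrow> bool"
  where "a_priori_estimate nrm \<sigma> T A \<tau> \<longleftrightarrow>
    (\<forall>N0 u0 \<phi> y. \<tau> * real N0 = T \<and> weighted_scheme \<sigma> A \<tau> N0 u0 \<phi> y \<longrightarrow>
      (\<forall>n<N0. nrm (y (Suc n)) \<le> nrm u0 + (\<Sum>k\<le>n. \<tau> * nrm (\<phi> k))))"

end

theory Submission
  imports Defs
begin

text \<open>Writing \<open>a = \<tau> d\<close>, one step reads \<open>(I + \<sigma> \<tau> A) y' = (I - (1 - \<sigma>) \<tau> A) y + \<tau> \<phi>\<close>. Diagonal dominance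
  gives \<open>\<parallel>(I + s A) x\<parallel> \<ge> \<parallel>x\<parallel>\<close> for all \<open>s \<ge> 0\<close>, and \<open>\<parallel>(I - s A) x\<parallel> \<le> \<parallel>x\<parallel>\<close> as long as
  \<open>s max a\<^sub>i\<^sub>i \<le> 1\<close>; this yields the estimate and stability.

  If \<open>a (1 - \<sigma>) > 1\<close>, a dominant matrix with a single nonzero row (or column), with entries \<open>d\<close> and
  \<open>\<plusminus>d\<close> in positions \<open>p\<close>, \<open>q\<close>, moves the \<open>q\<close> component of \<open>y\<close> to the \<open>p\<close> component amplified by
  at least \<open>a / (1 + \<sigma> a) > 1\<close>. Since \<open>A\<close> may depend on time, the roles of \<open>p\<close> and \<open>q\<close> can be
  exchanged at every step, and the solution grows geometrically in the number of steps.\<close>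

text \<open>All that the argument uses about a dominance condition and its norm, so that rows with
  the maximum norm and columns with the L1 norm share one proof. In \<open>amplifying_step\<close>
  the diagonal is normalized to \<open>max_diag B = 1\<close>, and \<open>a\<close> stands for
  \<open>\<tau>\<close> times the actual maximal diagonal entry.\<close>

locale dominance_norm =
  fixes dominant :: "real ^ 'm ^ 'm \<Rightarrow> bool"
    and nrm :: "real ^ 'm \<Rightarrow> real"
  assumes nrm_implicit_ge: "\<lbrakk>dominant M; 0 \<le> s\<rbrakk> \<Longrightarrow> nrm x \<le> nrm (x + s *\<^sub>R (M *v x))"
    and nrm_explicit_le:
      "\<lbrakk>dominant M; 0 \<le> s; s * max_diag M \<le> 1\<rbrakk> \<Longrightarrow> nrm (x - s *\<^sub>R (M *v x)) \<le> nrm x"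
    and nrm_triangle: "nrm (x + y) \<le> nrm x + nrm y"
    and nrm_scaleR: "nrm (c *\<^sub>R x) = \<bar>c\<bar> * nrm x"
    and component_le_nrm: "\<bar>x $ i\<bar> \<le> nrm x"
    and nrm_axis: "nrm (axis i 1) = 1"
    and dominant_scaleR: "\<lbrakk>dominant M; 0 \<le> d\<rbrakk> \<Longrightarrow> dominant (d *\<^sub>R M)"
    and amplifying_step:
      "\<lbrakk>p \<noteq> q; 0 \<le> \<sigma>; \<sigma> < 1; 1 < a * (1 - \<sigma>)\<rbrakk> \<Longrightarrow>
        \<exists>B z. dominant B \<and> max_diag B = 1 \<and>
          z + (\<sigma> * a) *\<^sub>R (B *v z) = y - ((1 - \<sigma>) * a) *\<^sub>R (B *v y) \<and>
          a / (1 + \<sigma> * a) * \<bar>y $ q\<bar> \<le> \<bar>z $ p\<bar>"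

section \<open>Largest diagonal entry and the rearranged step\<close>

lemma max_diag_ge: "M $ i $ i \<le> max_diag M"
  unfolding max_diag_def by (rule Max_ge) auto

lemma max_diag_eqI:
  assumes "M $ k $ k = b" "\<And>i. M $ i $ i \<le> b"
  shows "max_diag M = b"
  unfolding max_diag_def using assms by (intro Max_eqI) auto

lemma max_diag_scaleR:
  assumes "0 \<le> d"
  shows "max_diag (d *\<^sub>R M) = d * max_diag M"
proof -
  have "max_diag M \<in> range (\<lambda>i. M $ i $ i)"
    unfolding max_diag_def by (rule Max_in) auto
  then obtain k where k: "max_diag M = M $ k $ k" by auto
  show ?thesis
    by (rule max_diag_eqI[of _ k])
      (use assms k max_diag_ge[of M] in \<open>auto intro!: mult_left_mono\<close>)
qed

text \<open>Multiplying by \<open>\<tau>\<close> separates the operator acting on the new level from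
  the one acting on the old level; the locale assumptions bound these two.\<close>

lemma weighted_step_iff:
  fixes M :: "real ^ 'm ^ 'm"
  assumes "0 < \<tau>"
  shows "(1 / \<tau>) *\<^sub>R (z - y) + M *v (\<sigma> *\<^sub>R z + (1 - \<sigma>) *\<^sub>R y) = f \<longleftrightarrow>
    z + (\<sigma> * \<tau>) *\<^sub>R (M *v z) = y - ((1 - \<sigma>) * \<tau>) *\<^sub>R (M *v y) + \<tau> *\<^sub>R f" (is "?l = f \<longleftrightarrow> ?r")
proof -
  have "?l = f \<longleftrightarrow> \<tau> *\<^sub>R ?l = \<tau> *\<^sub>R f" using assms by simp
  also have "\<tau> *\<^sub>R ?l = z - y + (\<sigma> * \<tau>) *\<^sub>R (M *v z) + ((1 - \<sigma>) * \<tau>) *\<^sub>R (M *v y)"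
    using assms
    by (simp add: matrix_vector_right_distrib matrix_vector_mult_scaleR scaleR_add_right mult.commute)
  also have "\<dots> = \<tau> *\<^sub>R f \<longleftrightarrow> ?r" by (auto simp: algebra_simps)
  finally show ?thesis .
qed

section \<open>Componentwise bounds for the implicit and explicit operators\<close>

lemma row_split:
  fixes M :: "real ^ 'm ^ 'm"
  shows "(M *v x) $ i = M $ i $ i * x $ i + (\<Sum>j\<in>UNIV - {i}. M $ i $ j * x $ j)"
  unfolding matrix_vector_mult_def by (simp add: sum.remove[of UNIV i])

text \<open>Reverse triangle inequality with the diagonal term split off. No dominance enters yet,
  so that the bound can be used at one component (rows) or summed over all components
  (columns).\<close>

lemma abs_implicit_component_ge:
  fixes M :: "real ^ 'm ^ 'm"
  assumes "0 \<le> s" "0 \<le> M $ i $ i"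
  shows "(1 + s * M $ i $ i) * \<bar>x $ i\<bar> - s * (\<Sum>j\<in>UNIV - {i}. \<bar>M $ i $ j\<bar> * \<bar>x $ j\<bar>)
    \<le> \<bar>(x + s *\<^sub>R (M *v x)) $ i\<bar>"
proof -
  let ?S = "\<Sum>j\<in>UNIV - {i}. M $ i $ j * x $ j"
  have S: "\<bar>?S\<bar> \<le> (\<Sum>j\<in>UNIV - {i}. \<bar>M $ i $ j\<bar> * \<bar>x $ j\<bar>)"
    by (rule order.trans[OF sum_abs]) (simp add: abs_mult)
  have "(x + s *\<^sub>R (M *v x)) $ i = (1 + s * M $ i $ i) * x $ i + s * ?S"
    by (simp add: row_split algebra_simps)
  moreover have "\<bar>(1 + s * M $ i $ i) * x $ i\<bar> = (1 + s * M $ i $ i) * \<bar>x $ i\<bar>"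
    using assms by (simp add: abs_mult)
  moreover have "\<bar>s * ?S\<bar> \<le> s * (\<Sum>j\<in>UNIV - {i}. \<bar>M $ i $ j\<bar> * \<bar>x $ j\<bar>)"
    using S assms by (simp add: abs_mult mult_left_mono)
  ultimately show ?thesis by linarith
qed

text \<open>Here the step restriction enters: it keeps \<open>1 - s * M $ i $ i\<close> nonnegative,
  so this factor is its own absolute value.\<close>

lemma abs_explicit_component_le:
  fixes M :: "real ^ 'm ^ 'm"
  assumes "0 \<le> s" "s * max_diag M \<le> 1"
  shows "\<bar>(x - s *\<^sub>R (M *v x)) $ i\<bar>
    \<le> (1 - s * M $ i $ i) * \<bar>x $ i\<bar> + s * (\<Sum>j\<in>UNIV - {i}. \<bar>M $ i $ j\<bar> * \<bar>x $ j\<bar>)"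
proof -
  let ?S = "\<Sum>j\<in>UNIV - {i}. M $ i $ j * x $ j"
  have S: "\<bar>?S\<bar> \<le> (\<Sum>j\<in>UNIV - {i}. \<bar>M $ i $ j\<bar> * \<bar>x $ j\<bar>)"
    by (rule order.trans[OF sum_abs]) (simp add: abs_mult)
  have "s * M $ i $ i \<le> 1"
    using mult_left_mono[OF max_diag_ge[of M i] assms(1)] assms(2) by linarith
  then have "\<bar>(1 - s * M $ i $ i) * x $ i\<bar> = (1 - s * M $ i $ i) * \<bar>x $ i\<bar>"
    by (simp add: abs_mult)
  moreover have "(x - s *\<^sub>R (M *v x)) $ i = (1 - s * M $ i $ i) * x $ i - s * ?S"
    by (simp add: row_split algebra_simps)
  moreover have "\<bar>s * ?S\<bar> \<le> s * (\<Sum>j\<in>UNIV - {i}. \<bar>M $ i $ j\<bar> * \<bar>x $ j\<bar>)"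
    using S assms by (simp add: abs_mult mult_left_mono)
  ultimately show ?thesis by linarith
qed

section \<open>Off-diagonal sums under row and column dominance\<close>

lemma infnorm_attained:
  fixes x :: "real ^ 'm"
  obtains i where "infnorm x = \<bar>x $ i\<bar>"
proof -
  have "infnorm x = Sup (range (\<lambda>i. \<bar>x $ i\<bar>))"
    unfolding infnorm_cart by (rule arg_cong[of _ _ Sup]) auto
  also have "\<dots> = Max (range (\<lambda>i. \<bar>x $ i\<bar>))"
    by (rule cSup_eq_Max) auto
  also have "\<dots> \<in> range (\<lambda>i. \<bar>x $ i\<bar>)"
    by (rule Max_in) auto
  finally show ?thesis using that by auto
qed

lemma row_off_diagonal_le:
  assumes "row_dominant M"
  shows "(\<Sum>j\<in>UNIV - {i}. \<bar>M $ i $ j\<bar> * \<bar>x $ j\<bar>) \<le> M $ i $ i * infnorm x"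
proof -
  have "(\<Sum>j\<in>UNIV - {i}. \<bar>M $ i $ j\<bar> * \<bar>x $ j\<bar>) \<le> (\<Sum>j\<in>UNIV - {i}. \<bar>M $ i $ j\<bar>) * infnorm x"
    unfolding sum_distrib_right
    by (intro sum_mono mult_left_mono component_le_infnorm_cart) auto
  also have "\<dots> \<le> M $ i $ i * infnorm x"
    using assms by (intro mult_right_mono infnorm_pos_le) (auto simp: row_dominant_def)
  finally show ?thesis .
qed

text \<open>Exchanging the order of summation collects the off-diagonal entries of each column, and
  column dominance bounds them by the diagonal entry.\<close>

lemma column_off_diagonal_le:
  fixes x :: "real ^ 'm"
  assumes "column_dominant M"
  shows "(\<Sum>i\<in>UNIV. \<Sum>j\<in>UNIV - {i}. \<bar>M $ i $ j\<bar> * \<bar>x $ j\<bar>) \<le> (\<Sum>j\<in>UNIV. M $ j $ j * \<bar>x $ j\<bar>)"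
proof -
  have "(\<Sum>i\<in>UNIV. \<Sum>j\<in>UNIV - {i}. \<bar>M $ i $ j\<bar> * \<bar>x $ j\<bar>)
      = (\<Sum>i\<in>UNIV. \<Sum>j\<in>{j \<in> UNIV. i \<noteq> j}. \<bar>M $ i $ j\<bar> * \<bar>x $ j\<bar>)"
    by (intro sum.cong) auto
  also have "\<dots> = (\<Sum>j\<in>UNIV. \<Sum>i\<in>{i \<in> UNIV. i \<noteq> j}. \<bar>M $ i $ j\<bar> * \<bar>x $ j\<bar>)"
    by (rule sum.swap_restrict) auto
  also have "\<dots> = (\<Sum>j\<in>UNIV. (\<Sum>i\<in>UNIV - {j}. \<bar>M $ i $ j\<bar>) * \<bar>x $ j\<bar>)"
    unfolding sum_distrib_right by (intro sum.cong) auto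
  also have "\<dots> \<le> (\<Sum>j\<in>UNIV. M $ j $ j * \<bar>x $ j\<bar>)"
    using assms by (intro sum_mono mult_right_mono) (auto simp: column_dominant_def)
  finally show ?thesis .
qed

section \<open>Amplifying matrices above the threshold\<close>

lemma ex_distinct:
  assumes "2 \<le> CARD('m)"
  obtains p q :: "'m::finite" where "p \<noteq> q"
proof -
  have "\<not> card (UNIV :: 'm set) \<le> Suc 0" using assms by simp
  then show ?thesis using that by (auto simp: card_le_Suc0_iff_eq)
qed

text \<open>Supplies the sign of an off-diagonal entry for which two contributions to a component
  cannot cancel.\<close>

lemma ex_sign_abs_add:
  fixes u v :: real
  obtains c :: real where "\<bar>c\<bar> = 1" "\<bar>v + c * u\<bar> = \<bar>v\<bar> + \<bar>u\<bar>"
proof (cases "0 \<le> u * v")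
  case True
  then show ?thesis using that[of 1] by (auto simp: zero_le_mult_iff)
next
  case False
  then show ?thesis using that[of "-1"] by (auto simp: not_le mult_less_0_iff)
qed

text \<open>Only row \<open>p\<close> of \<open>B\<close> is nonzero, so the step fixes all other
  components. As \<open>y $ q\<close> is the same on both levels, the weights
  \<open>\<sigma>\<close> and \<open>1 - \<sigma>\<close> add up and it enters the equation for
  \<open>z $ p\<close> with the full factor \<open>a\<close>.\<close>

lemma row_amplifying_step:
  fixes y :: "real ^ 'm"
  assumes "p \<noteq> q" "0 \<le> \<sigma>" "\<sigma> < 1" "1 < a * (1 - \<sigma>)"
  shows "\<exists>B z. row_dominant B \<and> max_diag B = 1 \<and>
    z + (\<sigma> * a) *\<^sub>R (B *v z) = y - ((1 - \<sigma>) * a) *\<^sub>R (B *v y) \<and>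
    a / (1 + \<sigma> * a) * \<bar>y $ q\<bar> \<le> \<bar>z $ p\<bar>"
proof -
  have a: "0 < a" using assms(3,4)
    by (smt (verit) mult_nonpos_nonneg)
  then have D: "0 < 1 + \<sigma> * a" using assms(2) by (simp add: add_pos_nonneg)
  obtain c :: real where c: "\<bar>c\<bar> = 1"
    "\<bar>(a * (1 - \<sigma>) - 1) * y $ p + c * (a * y $ q)\<bar> = \<bar>(a * (1 - \<sigma>) - 1) * y $ p\<bar> + \<bar>a * y $ q\<bar>"
    by (rule ex_sign_abs_add)
  define B :: "real ^ 'm ^ 'm"
    where "B = (\<chi> k l. if k = p then if l = p then 1 else if l = q then c else 0 else 0)"
  \<comment> \<open>The solution of the scalar equation in row \<open>p\<close>, once
    \<open>z $ q = y $ q\<close> is inserted.\<close>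
  define w where "w = - ((a * (1 - \<sigma>) - 1) * y $ p + c * (a * y $ q)) / (1 + \<sigma> * a)"
  define z :: "real ^ 'm" where "z = (\<chi> k. if k = p then w else y $ k)"
  have Bv: "(B *v x) $ k = (if k = p then x $ p + c * x $ q else 0)" for x k
  proof -
    have "(\<Sum>j\<in>UNIV - {p}. (if j = q then c else 0) * x $ j) = c * x $ q"
      using assms(1) by (simp add: if_distrib[of "\<lambda>t. t * _"] sum.delta cong: if_cong)
    moreover have "(\<Sum>j\<in>UNIV - {p}. B $ p $ j * x $ j)
        = (\<Sum>j\<in>UNIV - {p}. (if j = q then c else 0) * x $ j)"
      by (intro sum.cong) (auto simp: B_def)
    ultimately show ?thesis
      by (auto simp: row_split[of B x p]) (auto simp: B_def matrix_vector_mult_def)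
  qed
  have "(\<Sum>j\<in>UNIV - {p}. \<bar>B $ p $ j\<bar>) = (\<Sum>j\<in>UNIV - {p}. if j = q then 1 else 0)"
    using c(1) by (intro sum.cong) (auto simp: B_def)
  also have "\<dots> = 1" using assms(1) by simp
  finally have "row_dominant B"
    unfolding row_dominant_def by (auto simp: B_def)
  moreover have "max_diag B = 1"
    by (rule max_diag_eqI[of _ p]) (auto simp: B_def)
  moreover have "z + (\<sigma> * a) *\<^sub>R (B *v z) = y - ((1 - \<sigma>) * a) *\<^sub>R (B *v y)"
  proof -
    have "(1 + \<sigma> * a) * w = - ((a * (1 - \<sigma>) - 1) * y $ p + c * (a * y $ q))"
      unfolding w_def using D by simp
    then show ?thesis
      using assms(1) by (auto simp: vec_eq_iff Bv z_def algebra_simps)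
  qed
  moreover have "a / (1 + \<sigma> * a) * \<bar>y $ q\<bar> \<le> \<bar>z $ p\<bar>"
  proof -
    have "\<bar>z $ p\<bar> = (\<bar>(a * (1 - \<sigma>) - 1) * y $ p\<bar> + \<bar>a * y $ q\<bar>) / (1 + \<sigma> * a)"
      unfolding z_def w_def using D by (simp flip: c(2))
    moreover have "a * \<bar>y $ q\<bar> = \<bar>a * y $ q\<bar>" using a by (simp add: abs_mult)
    ultimately show ?thesis using D by (simp add: divide_right_mono)
  qed
  ultimately show ?thesis by blast
qed

text \<open>Here \<open>B\<close> has rank one: its only nonzero column \<open>q\<close> is
  \<open>e\<close>, so the step moves \<open>y\<close> along \<open>e\<close> by an amount that
  depends on \<open>y $ q\<close> alone.\<close>

lemma column_amplifying_step:
  fixes y :: "real ^ 'm"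
  assumes "p \<noteq> q" "0 \<le> \<sigma>" "\<sigma> < 1" "1 < a * (1 - \<sigma>)"
  shows "\<exists>B z. column_dominant B \<and> max_diag B = 1 \<and>
    z + (\<sigma> * a) *\<^sub>R (B *v z) = y - ((1 - \<sigma>) * a) *\<^sub>R (B *v y) \<and>
    a / (1 + \<sigma> * a) * \<bar>y $ q\<bar> \<le> \<bar>z $ p\<bar>"
proof -
  have a: "0 < a" using assms(3,4)
    by (smt (verit) mult_nonpos_nonneg)
  then have D: "0 < 1 + \<sigma> * a" using assms(2) by (simp add: add_pos_nonneg)
  \<comment> \<open>Inserting \<open>z = y - (r * y $ q) *\<^sub>R e\<close> into the step leaves
    the scalar condition \<open>r * (1 + \<sigma> * a) = a\<close>.\<close>
  define r where "r = a / (1 + \<sigma> * a)"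
  have r: "0 < r" unfolding r_def using a D by simp
  obtain c :: real where c: "\<bar>c\<bar> = 1" "\<bar>y $ p + c * (r * y $ q)\<bar> = \<bar>y $ p\<bar> + \<bar>r * y $ q\<bar>"
    by (rule ex_sign_abs_add)
  \<comment> \<open>The entry \<open>- c\<close> turns the new \<open>p\<close> component into
    \<open>y $ p + c * (r * y $ q)\<close>, where \<open>c\<close> excludes cancellation.\<close>
  define e :: "real ^ 'm" where "e = (\<chi> k. if k = q then 1 else if k = p then - c else 0)"
  define B :: "real ^ 'm ^ 'm" where "B = (\<chi> k l. if l = q then e $ k else 0)"
  define z where "z = y - (r * y $ q) *\<^sub>R e"
  have Bv: "B *v x = x $ q *\<^sub>R e" for x
    by (simp add: vec_eq_iff B_def matrix_vector_mult_def if_distrib[of "\<lambda>t. t * _"] cong: if_cong)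
  have "(\<Sum>j\<in>UNIV - {q}. \<bar>B $ j $ q\<bar>) = (\<Sum>j\<in>UNIV - {q}. if j = p then 1 else 0)"
    using c(1) by (intro sum.cong) (auto simp: B_def e_def)
  also have "\<dots> = 1" using assms(1) by simp
  finally have "column_dominant B"
    unfolding column_dominant_def by (auto simp: B_def e_def)
  moreover have "max_diag B = 1"
    by (rule max_diag_eqI[of _ q]) (auto simp: B_def e_def)
  moreover have "z + (\<sigma> * a) *\<^sub>R (B *v z) = y - ((1 - \<sigma>) * a) *\<^sub>R (B *v y)"
  proof -
    have ra: "r * (1 + \<sigma> * a) = a" unfolding r_def using D by simp
    have zq: "z $ q = y $ q - r * y $ q" by (simp add: z_def e_def)
    have "\<sigma> * a * z $ q - r * y $ q = \<sigma> * a * y $ q - r * (1 + \<sigma> * a) * y $ q"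
      unfolding zq by (simp add: algebra_simps)
    also have "\<dots> = - ((1 - \<sigma>) * a * y $ q)" unfolding ra by (simp add: algebra_simps)
    finally have "(\<sigma> * a * z $ q - r * y $ q) *\<^sub>R e = - (((1 - \<sigma>) * a * y $ q) *\<^sub>R e)"
      by simp
    then show ?thesis
      unfolding Bv by (simp add: z_def scaleR_left_diff_distrib) (simp add: algebra_simps)
  qed
  moreover have "a / (1 + \<sigma> * a) * \<bar>y $ q\<bar> \<le> \<bar>z $ p\<bar>"
  proof -
    have "z $ p = y $ p + c * (r * y $ q)" using assms(1) by (simp add: z_def e_def)
    then show ?thesis using c(2) r by (simp add: abs_mult flip: r_def)
  qed
  ultimately show ?thesis by blast
qed

section \<open>The two pairs of dominance condition and norm\<close>

lemma row_dominance_norm: "dominance_norm (row_dominant :: real ^ 'm ^ 'm \<Rightarrow> bool) infnorm"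
proof
  fix M :: "real ^ 'm ^ 'm" and s :: real and x :: "real ^ 'm"
  assume M: "row_dominant M" and s: "0 \<le> s"
  \<comment> \<open>At a component where \<open>x\<close> is largest, the off-diagonal part is at
    most \<open>M $ i $ i * infnorm x\<close>, just what the diagonal term adds.\<close>
  obtain i where i: "infnorm x = \<bar>x $ i\<bar>" by (rule infnorm_attained)
  have "infnorm x = (1 + s * M $ i $ i) * \<bar>x $ i\<bar> - s * (M $ i $ i * infnorm x)"
    by (simp add: i algebra_simps)
  also have "\<dots> \<le> (1 + s * M $ i $ i) * \<bar>x $ i\<bar> - s * (\<Sum>j\<in>UNIV - {i}. \<bar>M $ i $ j\<bar> * \<bar>x $ j\<bar>)"
    using mult_left_mono[OF row_off_diagonal_le[OF M, of i x] s] by simp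
  also have "\<dots> \<le> \<bar>(x + s *\<^sub>R (M *v x)) $ i\<bar>"
    using M s by (intro abs_implicit_component_ge) (auto simp: row_dominant_def)
  also have "\<dots> \<le> infnorm (x + s *\<^sub>R (M *v x))" by (rule component_le_infnorm_cart)
  finally show "infnorm x \<le> infnorm (x + s *\<^sub>R (M *v x))" .
next
  fix M :: "real ^ 'm ^ 'm" and s :: real and x :: "real ^ 'm"
  assume M: "row_dominant M" and s: "0 \<le> s" "s * max_diag M \<le> 1"
  \<comment> \<open>For the upper bound the component is chosen where the image, not
    \<open>x\<close>, is largest.\<close>
  obtain i where i: "infnorm (x - s *\<^sub>R (M *v x)) = \<bar>(x - s *\<^sub>R (M *v x)) $ i\<bar>"
    by (rule infnorm_attained)
  have "s * M $ i $ i \<le> 1"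
    using mult_left_mono[OF max_diag_ge[of M i] s(1)] s(2) by linarith
  then have 1: "(1 - s * M $ i $ i) * \<bar>x $ i\<bar> \<le> (1 - s * M $ i $ i) * infnorm x"
    by (intro mult_left_mono component_le_infnorm_cart) auto
  have "infnorm (x - s *\<^sub>R (M *v x))
      \<le> (1 - s * M $ i $ i) * \<bar>x $ i\<bar> + s * (\<Sum>j\<in>UNIV - {i}. \<bar>M $ i $ j\<bar> * \<bar>x $ j\<bar>)"
    unfolding i by (rule abs_explicit_component_le[OF s])
  also have "\<dots> \<le> (1 - s * M $ i $ i) * infnorm x + s * (M $ i $ i * infnorm x)"
    using 1 mult_left_mono[OF row_off_diagonal_le[OF M, of i x] s(1)] by linarith
  also have "\<dots> = infnorm x" by (simp add: algebra_simps)
  finally show "infnorm (x - s *\<^sub>R (M *v x)) \<le> infnorm x" .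
next
  show "infnorm (axis i 1 :: real ^ 'm) = 1" for i
  proof -
    obtain k where k: "infnorm (axis i 1 :: real ^ 'm) = \<bar>(axis i 1 :: real ^ 'm) $ k\<bar>"
      by (rule infnorm_attained)
    moreover have "\<bar>(axis i 1 :: real ^ 'm) $ i\<bar> \<le> infnorm (axis i 1 :: real ^ 'm)"
      by (rule component_le_infnorm_cart)
    ultimately show ?thesis by (auto simp: axis_def split: if_splits)
  qed
  show "row_dominant (d *\<^sub>R M)" if "row_dominant M" "0 \<le> d" for d :: real and M :: "real ^ 'm ^ 'm"
    using that by (auto simp: row_dominant_def abs_mult mult_left_mono simp flip: sum_distrib_left)
qed (use row_amplifying_step in \<open>auto simp: infnorm_mul intro: infnorm_triangle component_le_infnorm_cart\<close>)

lemma column_dominance_norm: "dominance_norm (column_dominant :: real ^ 'm ^ 'm \<Rightarrow> bool) L1_norm"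
proof
  fix M :: "real ^ 'm ^ 'm" and s :: real and x :: "real ^ 'm"
  assume M: "column_dominant M" and s: "0 \<le> s"
  \<comment> \<open>Column dominance gives nothing for a single component; the diagonal and
    off-diagonal terms are compared only after summing over all of them.\<close>
  have "L1_norm x = (\<Sum>i\<in>UNIV. (1 + s * M $ i $ i) * \<bar>x $ i\<bar>) - s * (\<Sum>j\<in>UNIV. M $ j $ j * \<bar>x $ j\<bar>)"
    by (simp add: L1_norm_def algebra_simps sum.distrib sum_distrib_left)
  also have "\<dots> \<le> (\<Sum>i\<in>UNIV. (1 + s * M $ i $ i) * \<bar>x $ i\<bar>)
      - s * (\<Sum>i\<in>UNIV. \<Sum>j\<in>UNIV - {i}. \<bar>M $ i $ j\<bar> * \<bar>x $ j\<bar>)"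
    using mult_left_mono[OF column_off_diagonal_le[OF M, of x] s] by simp
  also have "\<dots> = (\<Sum>i\<in>UNIV. (1 + s * M $ i $ i) * \<bar>x $ i\<bar>
      - s * (\<Sum>j\<in>UNIV - {i}. \<bar>M $ i $ j\<bar> * \<bar>x $ j\<bar>))"
    by (simp add: sum_subtractf sum_distrib_left)
  also have "\<dots> \<le> L1_norm (x + s *\<^sub>R (M *v x))"
    unfolding L1_norm_def using M s
    by (intro sum_mono abs_implicit_component_ge) (auto simp: column_dominant_def)
  finally show "L1_norm x \<le> L1_norm (x + s *\<^sub>R (M *v x))" .
next
  fix M :: "real ^ 'm ^ 'm" and s :: real and x :: "real ^ 'm"
  assume M: "column_dominant M" and s: "0 \<le> s" "s * max_diag M \<le> 1"
  have "L1_norm (x - s *\<^sub>R (M *v x)) \<le> (\<Sum>i\<in>UNIV. (1 - s * M $ i $ i) * \<bar>x $ i\<bar>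
      + s * (\<Sum>j\<in>UNIV - {i}. \<bar>M $ i $ j\<bar> * \<bar>x $ j\<bar>))"
    unfolding L1_norm_def by (intro sum_mono abs_explicit_component_le s)
  also have "\<dots> = (\<Sum>i\<in>UNIV. (1 - s * M $ i $ i) * \<bar>x $ i\<bar>)
      + s * (\<Sum>i\<in>UNIV. \<Sum>j\<in>UNIV - {i}. \<bar>M $ i $ j\<bar> * \<bar>x $ j\<bar>)"
    by (simp add: sum.distrib sum_distrib_left)
  also have "\<dots> \<le> (\<Sum>i\<in>UNIV. (1 - s * M $ i $ i) * \<bar>x $ i\<bar>) + s * (\<Sum>j\<in>UNIV. M $ j $ j * \<bar>x $ j\<bar>)"
    using mult_left_mono[OF column_off_diagonal_le[OF M, of x] s(1)] by simp
  also have "\<dots> = L1_norm x"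
    by (simp add: L1_norm_def algebra_simps sum_subtractf sum_distrib_left)
  finally show "L1_norm (x - s *\<^sub>R (M *v x)) \<le> L1_norm x" .
next
  show "L1_norm (x + y) \<le> L1_norm x + L1_norm y" for x y :: "real ^ 'm"
    unfolding L1_norm_def sum.distrib[symmetric] by (intro sum_mono) auto
  show "L1_norm (c *\<^sub>R x) = \<bar>c\<bar> * L1_norm x" for c and x :: "real ^ 'm"
    by (simp add: L1_norm_def abs_mult sum_distrib_left)
  show "\<bar>x $ i\<bar> \<le> L1_norm x" for x :: "real ^ 'm" and i
    unfolding L1_norm_def by (rule member_le_sum) auto
  show "L1_norm (axis i 1 :: real ^ 'm) = 1" for i
    by (simp add: L1_norm_def axis_def if_distrib[of abs] cong: if_cong)
  show "column_dominant (d *\<^sub>R M)" if "column_dominant M" "0 \<le> d" for d :: real and M :: "real ^ 'm ^ 'm"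
    using that by (auto simp: column_dominant_def abs_mult mult_left_mono simp flip: sum_distrib_left)
qed (rule column_amplifying_step)

section \<open>A priori estimate and stability under the step restriction\<close>

context dominance_norm
begin

lemma nrm_step_le:
  assumes "dominant M" "0 \<le> \<sigma>" "\<sigma> \<le> 1" "0 < \<tau>" "(1 - \<sigma>) * \<tau> * max_diag M \<le> 1"
    and "(1 / \<tau>) *\<^sub>R (z - y) + M *v (\<sigma> *\<^sub>R z + (1 - \<sigma>) *\<^sub>R y) = f"
  shows "nrm z \<le> nrm y + \<tau> * nrm f"
proof -
  have "nrm z \<le> nrm (z + (\<sigma> * \<tau>) *\<^sub>R (M *v z))"
    using assms by (intro nrm_implicit_ge) auto
  also have "\<dots> = nrm (y - ((1 - \<sigma>) * \<tau>) *\<^sub>R (M *v y) + \<tau> *\<^sub>R f)"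
    using weighted_step_iff[OF assms(4)] assms(6) by metis
  also have "\<dots> \<le> nrm (y - ((1 - \<sigma>) * \<tau>) *\<^sub>R (M *v y)) + nrm (\<tau> *\<^sub>R f)"
    by (rule nrm_triangle)
  also have "\<dots> \<le> nrm y + \<tau> * nrm f"
    using assms nrm_explicit_le[of M "(1 - \<sigma>) * \<tau>" y] by (simp add: nrm_scaleR)
  finally show ?thesis .
qed

text \<open>The one-step bound is summed over the levels. The product form of the restriction also
  covers \<open>\<sigma> = 1\<close> and a zero diagonal.\<close>

lemma a_priori_estimateI:
  assumes "0 \<le> \<sigma>" "\<sigma> \<le> 1" "0 < \<tau>" "A \<in> dominant_family dominant T"
    and "\<And>t. t \<in> {0..T} \<Longrightarrow> (1 - \<sigma>) * \<tau> * max_diag (A t) \<le> 1"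
  shows "a_priori_estimate nrm \<sigma> T A \<tau>"
  unfolding a_priori_estimate_def
proof (intro allI impI)
  fix N0 u0 \<phi> y n
  assume H: "\<tau> * real N0 = T \<and> weighted_scheme \<sigma> A \<tau> N0 u0 \<phi> y" and "n < N0"
  have step: "nrm (y (Suc k)) \<le> nrm (y k) + \<tau> * nrm (\<phi> k)" if "k < N0" for k
  proof -
    let ?t = "\<sigma> * (real (Suc k) * \<tau>) + (1 - \<sigma>) * (real k * \<tau>)"
    \<comment> \<open>The sampling time stays in \<open>{0..T}\<close> because
      \<open>0 \<le> \<sigma> \<le> 1\<close> and \<open>k < N0\<close>, so dominance is available
      there.\<close>
    have t: "?t = (real k + \<sigma>) * \<tau>" by (simp add: algebra_simps)
    have "(real k + \<sigma>) * \<tau> \<le> real N0 * \<tau>"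
      using that assms by (intro mult_right_mono) linarith+
    then have "?t \<in> {0..T}" unfolding t using H assms by (auto simp: mult.commute)
    then show ?thesis
      using assms H that
      by (intro nrm_step_le[of "A ?t"]) (auto simp: dominant_family_def weighted_scheme_def)
  qed
  from \<open>n < N0\<close> show "nrm (y (Suc n)) \<le> nrm u0 + (\<Sum>k\<le>n. \<tau> * nrm (\<phi> k))"
  proof (induction n)
    case 0
    then show ?case using step[of 0] H by (simp add: weighted_scheme_def)
  next
    case (Suc n)
    then show ?case using step[of "Suc n"] by simp
  qed
qed

text \<open>At most \<open>N0\<close> terms of weight \<open>\<tau>\<close> add up to at most
  \<open>T\<close> times the maximum. Hence \<open>m1 = 1\<close> and \<open>m2 = T\<close>,
  independent of the problem and of the step.\<close>

lemma two_level_stableI: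
  assumes "0 < T" and "\<And>A \<tau>. (A, \<tau>) \<in> P \<Longrightarrow> a_priori_estimate nrm \<sigma> T A \<tau>"
  shows "two_level_stable nrm \<sigma> T P"
proof -
  have "nrm (y (Suc n)) \<le> nrm u0 + T * Max ((\<lambda>k. nrm (\<phi> k)) ` {..n})"
    if "(A, \<tau>) \<in> P" "0 < \<tau>" "\<tau> * real N0 = T" "weighted_scheme \<sigma> A \<tau> N0 u0 \<phi> y" "n < N0"
    for A \<tau> N0 u0 \<phi> y n
  proof -
    let ?m = "Max ((\<lambda>k. nrm (\<phi> k)) ` {..n})"
    have le: "nrm (\<phi> k) \<le> ?m" if "k \<le> n" for k
      using that by (intro Max_ge) auto
    \<comment> \<open>Nonnegativity of the norm is read off from an arbitrary component; it allows
      \<open>Suc n\<close> to be enlarged to \<open>N0\<close>.\<close>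
    have m: "0 \<le> ?m" using component_le_nrm[of "\<phi> 0" undefined] le[of 0] by linarith
    have "(\<Sum>k\<le>n. \<tau> * nrm (\<phi> k)) \<le> (\<Sum>k\<le>n. \<tau> * ?m)"
      using le \<open>0 < \<tau>\<close> by (intro sum_mono mult_left_mono) auto
    also have "\<dots> = (\<tau> * real (Suc n)) * ?m" by simp
    also have "\<dots> \<le> (\<tau> * real N0) * ?m"
      using that m by (intro mult_right_mono mult_left_mono) auto
    finally show ?thesis
      using assms(2)[OF that(1)] that unfolding a_priori_estimate_def by fastforce
  qed
  then show ?thesis
    unfolding two_level_stable_def using assms(1)
    by (intro exI[of _ 1] exI[of _ T] conjI) auto
qed

lemma step_restriction_estimate:
  assumes "0 \<le> \<sigma>" "\<sigma> < 1" "0 < \<tau>" "A \<in> dominant_family dominant T"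
    and "step_restriction (1 / (1 - \<sigma>)) T A \<tau>"
  shows "a_priori_estimate nrm \<sigma> T A \<tau>"
proof (rule a_priori_estimateI)
  fix t assume t: "t \<in> {0..T}"
  show "(1 - \<sigma>) * \<tau> * max_diag (A t) \<le> 1"
  proof (cases "0 < max_diag (A t)")
    case True
    then have "\<tau> \<le> 1 / (1 - \<sigma>) * inverse (max_diag (A t))"
      using assms(5) t by (auto simp: step_restriction_def)
    then show ?thesis using True assms(2) by (simp add: field_simps)
  next
    \<comment> \<open>The guard in \<open>step_restriction\<close> gives no bound on
      \<open>\<tau>\<close> here, but the product is not positive anyway.\<close>
    case False
    then have "(1 - \<sigma>) * \<tau> * max_diag (A t) \<le> 0"
      using assms by (intro mult_nonneg_nonpos) auto
    then show ?thesis by simp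
  qed
qed (use assms in auto)

section \<open>Necessity of the step restriction\<close>

text \<open>Scaling \<open>A\<close> like \<open>\<kappa> / \<tau>\<close> meets the restriction
  with equality for every \<open>\<tau>\<close>, while the growth factor per step depends only on
  \<open>\<kappa>\<close> and \<open>\<sigma>\<close>. Refining the grid on \<open>{0..T}\<close>
  then defeats any \<open>m1\<close>.\<close>

lemma not_stable_above_restriction:
  assumes "0 \<le> \<sigma>" "\<sigma> < 1" "0 < T" "2 \<le> CARD('m)" "1 < \<kappa> * (1 - \<sigma>)"
  shows "\<not> two_level_stable nrm \<sigma> T
    {(A, \<tau>). A \<in> dominant_family dominant T \<and> 0 < \<tau> \<and> step_restriction \<kappa> T A \<tau>}"
proof
  assume "two_level_stable nrm \<sigma> T
    {(A, \<tau>). A \<in> dominant_family dominant T \<and> 0 < \<tau> \<and> step_restriction \<kappa> T A \<tau>}"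
  then obtain m1 m2 where "\<forall>(A, \<tau>)\<in>{(A, \<tau>). A \<in> dominant_family dominant T \<and> 0 < \<tau> \<and>
        step_restriction \<kappa> T A \<tau>}. \<forall>N0 u0 \<phi> y.
      0 < \<tau> \<and> \<tau> * real N0 = T \<and> weighted_scheme \<sigma> A \<tau> N0 u0 \<phi> y \<longrightarrow>
      (\<forall>n<N0. nrm (y (Suc n)) \<le> m1 * nrm u0 + m2 * Max ((\<lambda>k. nrm (\<phi> k)) ` {..n}))"
    unfolding two_level_stable_def by (elim exE conjE)
  then have stable: "nrm (y (Suc n)) \<le> m1 * nrm u0 + m2 * Max ((\<lambda>k. nrm (\<phi> k)) ` {..n})"
    if "A \<in> dominant_family dominant T" "0 < \<tau>" "step_restriction \<kappa> T A \<tau>"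
      "\<tau> * real N0 = T" "weighted_scheme \<sigma> A \<tau> N0 u0 \<phi> y" "n < N0" for A \<tau> N0 u0 \<phi> y n
    using that by auto
  obtain p q :: 'm where pq: "p \<noteq> q"
    using assms(4) by (rule ex_distinct)
  have \<kappa>: "0 < \<kappa>" using assms(2,5) by (smt (verit) mult_nonpos_nonneg)
  define \<rho> where "\<rho> = \<kappa> / (1 + \<sigma> * \<kappa>)"
  have \<rho>: "1 < \<rho>"
    unfolding \<rho>_def using assms \<kappa> by (simp add: add_pos_nonneg algebra_simps)
  \<comment> \<open>The condition \<open>p \<noteq> q\<close> is moved under the existential
    quantifier so that matrix and new level become total functions of \<open>p\<close>,
    \<open>q\<close>, \<open>y\<close>.\<close>
  have "\<forall>p q y. \<exists>B z. p \<noteq> q \<longrightarrow> dominant B \<and> max_diag B = 1 \<and>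
      z + (\<sigma> * \<kappa>) *\<^sub>R (B *v z) = y - ((1 - \<sigma>) * \<kappa>) *\<^sub>R (B *v y) \<and> \<rho> * \<bar>y $ q\<bar> \<le> \<bar>z $ p\<bar>"
    unfolding \<rho>_def using amplifying_step[OF _ assms(1,2,5)] by blast
  then obtain BF ZF where F: "\<And>p q y. p \<noteq> q \<Longrightarrow> dominant (BF p q y) \<and> max_diag (BF p q y) = 1 \<and>
      ZF p q y + (\<sigma> * \<kappa>) *\<^sub>R (BF p q y *v ZF p q y) = y - ((1 - \<sigma>) * \<kappa>) *\<^sub>R (BF p q y *v y) \<and>
      \<rho> * \<bar>y $ q\<bar> \<le> \<bar>ZF p q y $ p\<bar>"
    by metis
  \<comment> \<open>The index of the component followed at level \<open>n\<close>; it alternates, so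
    each step amplifies what the previous one produced.\<close>
  define src where "src n = (if even n then q else p)" for n :: nat
  have src: "src (Suc n) \<noteq> src n" for n using pq by (auto simp: src_def)
  define y where "y = rec_nat (axis q 1) (\<lambda>n v. ZF (src (Suc n)) (src n) v)"
  have y_simps: "y 0 = axis q 1" "y (Suc n) = ZF (src (Suc n)) (src n) (y n)" for n
    by (simp_all add: y_def)
  define B where "B n = BF (src (Suc n)) (src n) (y n)" for n
  have B: "dominant (B n)" "max_diag (B n) = 1"
    "y (Suc n) + (\<sigma> * \<kappa>) *\<^sub>R (B n *v y (Suc n)) = y n - ((1 - \<sigma>) * \<kappa>) *\<^sub>R (B n *v y n)"
    "\<rho> * \<bar>y n $ src n\<bar> \<le> \<bar>y (Suc n) $ src (Suc n)\<bar>" for n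
    using F[OF src, of n "y n"] by (auto simp: B_def y_simps)
  have grow: "\<rho> ^ n \<le> \<bar>y n $ src n\<bar>" for n
  proof (induction n)
    case 0
    then show ?case by (simp add: y_simps src_def axis_def)
  next
    case (Suc n)
    have "\<rho> ^ Suc n \<le> \<rho> * \<bar>y n $ src n\<bar>" using Suc \<rho> by simp
    then show ?case using B(4)[of n] by linarith
  qed
  \<comment> \<open>The sequences \<open>y\<close> and \<open>B\<close> involve
    \<open>\<kappa>\<close> but not \<open>\<tau>\<close>, so the number of steps, and with it
    \<open>\<tau>\<close>, can be fixed only now.\<close>
  obtain n where n: "m1 < \<rho> ^ n" using real_arch_pow[OF \<rho>] by blast
  define \<tau> where "\<tau> = T / real (Suc n)"
  have \<tau>: "0 < \<tau>" "\<tau> * real (Suc n) = T" using assms(3) by (simp_all add: \<tau>_def)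
  \<comment> \<open>The \<open>k\<close>-th step samples \<open>A\<close> at the time \<open>(k + \<sigma>) \<tau>\<close>, where \<open>A\<close> is \<open>(\<kappa> / \<tau>) B k\<close>.\<close>
  define A where "A t = (\<kappa> / \<tau>) *\<^sub>R B (nat \<lfloor>t / \<tau> - \<sigma>\<rfloor>)" for t
  have A: "A (\<sigma> * (real (Suc k) * \<tau>) + (1 - \<sigma>) * (real k * \<tau>)) = (\<kappa> / \<tau>) *\<^sub>R B k" for k
  proof -
    have "(\<sigma> * (real (Suc k) * \<tau>) + (1 - \<sigma>) * (real k * \<tau>)) / \<tau> - \<sigma> = real k"
      using \<tau>(1) by (simp add: field_simps)
    then show ?thesis unfolding A_def by simp
  qed
  have diag: "max_diag (A t) = \<kappa> / \<tau>" for t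
    using \<kappa> \<tau>(1) by (simp add: A_def max_diag_scaleR B)
  have "weighted_scheme \<sigma> A \<tau> (Suc n) (axis q 1) (\<lambda>_. 0) y"
    unfolding weighted_scheme_def A weighted_step_iff[OF \<tau>(1)]
    using B(3) \<tau>(1) by (simp add: y_simps(1) flip: scaleR_matrix_vector_assoc)
  moreover have "A \<in> dominant_family dominant T"
    using \<kappa> \<tau>(1) B(1) by (auto simp: dominant_family_def A_def intro!: dominant_scaleR)
  moreover have "step_restriction \<kappa> T A \<tau>"
    using \<kappa> \<tau>(1) by (simp add: step_restriction_def diag)
  ultimately have "nrm (y (Suc n)) \<le> m1 * nrm (axis q 1)
      + m2 * Max ((\<lambda>k. nrm 0) ` {..n})"
    using stable[of A \<tau> "Suc n" _ "\<lambda>_. 0" y n] \<tau> by auto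
  moreover have "nrm 0 = 0" using nrm_scaleR[of 0 0] by simp
  moreover have "(\<lambda>k. 0 :: real) ` {..n} = {0}" by auto
  ultimately have "nrm (y (Suc n)) \<le> m1" by (simp add: nrm_axis)
  \<comment> \<open>The solution is compared at level \<open>Suc n\<close>, one beyond the exponent
    chosen.\<close>
  moreover have "\<rho> ^ n \<le> \<rho> ^ Suc n" using \<rho> by (intro power_increasing) auto
  ultimately show False
    using n grow[of "Suc n"] component_le_nrm[of "y (Suc n)" "src (Suc n)"] by linarith
qed

text \<open>A single amplifying step from a unit vector with \<open>\<phi> 0 = 0\<close> already
  violates the estimate, so an \<open>A\<close> constant in time suffices.\<close>

lemma estimate_fails_above_restriction:
  assumes "0 \<le> \<sigma>" "\<sigma> < 1" "2 \<le> CARD('m)" "0 < \<tau>" "0 < d" "1 < \<tau> * d * (1 - \<sigma>)"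
    and "0 < N0" "\<tau> * real N0 = T"
  shows "\<exists>A \<in> dominant_family dominant T.
    (\<forall>t. max_diag (A t) = d) \<and> \<not> a_priori_estimate nrm \<sigma> T A \<tau>"
proof -
  obtain p q :: 'm where pq: "p \<noteq> q"
    using assms(3) by (rule ex_distinct)
  let ?\<rho> = "\<tau> * d / (1 + \<sigma> * (\<tau> * d))"
  have \<rho>: "1 < ?\<rho>"
    using assms by (simp add: add_pos_nonneg algebra_simps)
  let ?y = "axis q 1 :: real ^ 'm"
  obtain B z where B: "dominant B" "max_diag B = 1"
    "z + (\<sigma> * (\<tau> * d)) *\<^sub>R (B *v z) = ?y - ((1 - \<sigma>) * (\<tau> * d)) *\<^sub>R (B *v ?y)"
    "?\<rho> * \<bar>?y $ q\<bar> \<le> \<bar>z $ p\<bar>"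
    using amplifying_step[OF pq assms(1,2,6), of ?y] by auto
  define A where "A = (\<lambda>t :: real. d *\<^sub>R B)"
  define y where "y n = (if n = 0 then ?y else z)" for n :: nat
  \<comment> \<open>From level 1 on, the right-hand side balances \<open>A\<close> applied to
    \<open>z\<close>, so the constant value \<open>z\<close> continues the solution to all
    \<open>N0\<close> steps.\<close>
  define \<phi> where "\<phi> n = (if n = 0 then 0 else d *\<^sub>R (B *v z))" for n :: nat
  have "A \<in> dominant_family dominant T"
    using assms(5) B(1) by (auto simp: dominant_family_def A_def intro!: dominant_scaleR)
  moreover have "max_diag (A t) = d" for t
    using assms(5) B(2) by (simp add: A_def max_diag_scaleR)
  moreover have "\<not> a_priori_estimate nrm \<sigma> T A \<tau>"
  proof
    assume est: "a_priori_estimate nrm \<sigma> T A \<tau>"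
    have "weighted_scheme \<sigma> A \<tau> N0 ?y \<phi> y"
      unfolding weighted_scheme_def weighted_step_iff[OF assms(4)]
      using B(3)
      by (auto simp: y_def \<phi>_def A_def algebra_simps simp flip: scaleR_matrix_vector_assoc)
    then have "nrm (y (Suc 0)) \<le> nrm ?y + (\<Sum>k\<le>0. \<tau> * nrm (\<phi> k))"
      using est assms(7,8) unfolding a_priori_estimate_def by blast
    moreover have "nrm 0 = 0" using nrm_scaleR[of 0 0] by simp
    ultimately have "nrm z \<le> 1" by (simp add: y_def \<phi>_def nrm_axis)
    moreover have "?\<rho> \<le> \<bar>z $ p\<bar>" using B(4) by (simp add: axis_def)
    ultimately show False using \<rho> component_le_nrm[of z p] by linarith
  qed
  ultimately show ?thesis by blast
qed

end

text \<open>The necessity claims need an off-diagonal entry: for a scalar problem with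
  \<open>a = \<tau> * d\<close> one only needs
  \<open>\<bar>1 - (1 - \<sigma>) * a\<bar> \<le> 1 + \<sigma> * a\<close>, that is
  \<open>(1 - 2 * \<sigma>) * a \<le> 2\<close>, which is weaker. A step that does not divide
  \<open>T\<close> would make the estimate vacuous, hence the condition on
  \<open>N0\<close>.\<close>

theorem theorem23:
  fixes dominant :: "real ^ 'm ^ 'm \<Rightarrow> bool"
    and nrm :: "real ^ 'm \<Rightarrow> real"
    and \<sigma> T :: real
  assumes "(dominant = row_dominant \<and> nrm = infnorm) \<or> (dominant = column_dominant \<and> nrm = L1_norm)"
    and "0 \<le> \<sigma>"
    and "0 < T"
  shows
    "(\<sigma> = 1 \<longrightarrow>
        two_level_stable nrm \<sigma> T (dominant_family dominant T \<times> {0<..}) \<and>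
        (\<forall>A \<in> dominant_family dominant T. \<forall>\<tau>>0. a_priori_estimate nrm \<sigma> T A \<tau>))
   \<and> (\<sigma> < 1 \<longrightarrow>
        two_level_stable nrm \<sigma> T
          {(A, \<tau>). A \<in> dominant_family dominant T \<and> 0 < \<tau> \<and> step_restriction (1 / (1 - \<sigma>)) T A \<tau>} \<and>
        (\<forall>A \<in> dominant_family dominant T. \<forall>\<tau>>0.
          step_restriction (1 / (1 - \<sigma>)) T A \<tau> \<longrightarrow> a_priori_estimate nrm \<sigma> T A \<tau>))
   \<and> (\<sigma> < 1 \<and> 2 \<le> CARD('m) \<longrightarrow>
        (\<forall>\<kappa>>0.
          two_level_stable nrm \<sigma> T
            {(A, \<tau>). A \<in> dominant_family dominant T \<and> 0 < \<tau> \<and> step_restriction \<kappa> T A \<tau>}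
          \<longleftrightarrow> \<kappa> \<le> 1 / (1 - \<sigma>)) \<and>
        (\<forall>\<tau>>0. \<forall>d>0. (\<exists>N0>0. \<tau> * real N0 = T) \<longrightarrow>
          ((\<forall>A \<in> dominant_family dominant T.
              (\<forall>t\<in>{0..T}. max_diag (A t) = d) \<longrightarrow> a_priori_estimate nrm \<sigma> T A \<tau>)
           \<longleftrightarrow> \<tau> \<le> 1 / (1 - \<sigma>) * inverse d)))"
proof -
  interpret dominance_norm dominant nrm
    using assms(1) row_dominance_norm column_dominance_norm by auto
  let ?P = "\<lambda>\<kappa>. {(A, \<tau>). A \<in> dominant_family dominant T \<and> 0 < \<tau> \<and> step_restriction \<kappa> T A \<tau>}"
  have implicit: "a_priori_estimate nrm \<sigma> T A \<tau>"
    if "\<sigma> = 1" "A \<in> dominant_family dominant T" "0 < \<tau>" for A \<tau>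
    using that by (intro a_priori_estimateI) auto
  have implicit_stable: "two_level_stable nrm \<sigma> T (dominant_family dominant T \<times> {0<..})" if "\<sigma> = 1"
    using assms(3) implicit[OF that] by (intro two_level_stableI) auto
  have stable: "two_level_stable nrm \<sigma> T (?P \<kappa>)" if "\<sigma> < 1" "\<kappa> \<le> 1 / (1 - \<sigma>)" for \<kappa>
  proof (rule two_level_stableI[OF assms(3)])
    fix A \<tau> assume "(A, \<tau>) \<in> ?P \<kappa>"
    then have A: "A \<in> dominant_family dominant T" "0 < \<tau>" "step_restriction \<kappa> T A \<tau>" by auto
    \<comment> \<open>A smaller \<open>\<kappa>\<close> is a stronger restriction, so every
      \<open>\<kappa>\<close> up to the threshold reduces to the threshold itself.\<close>
    have "\<kappa> * inverse x \<le> 1 / (1 - \<sigma>) * inverse x" if "0 < x" for x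
      using that \<open>\<kappa> \<le> 1 / (1 - \<sigma>)\<close> by (intro mult_right_mono) auto
    then have "step_restriction (1 / (1 - \<sigma>)) T A \<tau>"
      using A(3) unfolding step_restriction_def by (meson order.trans)
    then show "a_priori_estimate nrm \<sigma> T A \<tau>"
      using step_restriction_estimate assms(2) A that(1) by blast
  qed
  have sharp: "\<kappa> \<le> 1 / (1 - \<sigma>)"
    if "\<sigma> < 1" "2 \<le> CARD('m)" "two_level_stable nrm \<sigma> T (?P \<kappa>)" for \<kappa>
  proof (rule ccontr)
    assume "\<not> \<kappa> \<le> 1 / (1 - \<sigma>)"
    then have "1 < \<kappa> * (1 - \<sigma>)" using that(1) by (simp add: field_simps)
    then show False using not_stable_above_restriction assms that by blast
  qed
  have estimate_iff: "(\<forall>A \<in> dominant_family dominant T.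
        (\<forall>t\<in>{0..T}. max_diag (A t) = d) \<longrightarrow> a_priori_estimate nrm \<sigma> T A \<tau>)
      \<longleftrightarrow> \<tau> \<le> 1 / (1 - \<sigma>) * inverse d" (is "?E \<longleftrightarrow> ?R")
    if "\<sigma> < 1" "2 \<le> CARD('m)" "0 < \<tau>" "0 < d" "0 < N0" "\<tau> * real N0 = T" for \<tau> d N0
  proof
    assume ?R
    then show ?E
      using step_restriction_estimate assms(2) that by (simp add: step_restriction_def)
  next
    assume ?E
    show ?R
    proof (rule ccontr)
      assume "\<not> ?R"
      then have "1 < \<tau> * d * (1 - \<sigma>)" using that(1,4) by (simp add: field_simps)
      then show False
        using estimate_fails_above_restriction[OF assms(2) that(1-4) _ that(5,6)] \<open>?E\<close> by blast
    qed
  qed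
  have estimate_iff': "\<forall>\<tau>>0. \<forall>d>0. (\<exists>N0>0. \<tau> * real N0 = T) \<longrightarrow>
      ((\<forall>A \<in> dominant_family dominant T.
          (\<forall>t\<in>{0..T}. max_diag (A t) = d) \<longrightarrow> a_priori_estimate nrm \<sigma> T A \<tau>)
       \<longleftrightarrow> \<tau> \<le> 1 / (1 - \<sigma>) * inverse d)" if "\<sigma> < 1" "2 \<le> CARD('m)"
  proof (intro allI impI)
    fix \<tau> d :: real assume \<tau>d: "0 < \<tau>" "0 < d" and "\<exists>N0>0. \<tau> * real N0 = T"
    then obtain N0 where N0: "0 < N0" "\<tau> * real N0 = T" by blast
    show "(\<forall>A \<in> dominant_family dominant T.
          (\<forall>t\<in>{0..T}. max_diag (A t) = d) \<longrightarrow> a_priori_estimate nrm \<sigma> T A \<tau>)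
       \<longleftrightarrow> \<tau> \<le> 1 / (1 - \<sigma>) * inverse d"
      by (rule estimate_iff[OF that \<tau>d N0])
  qed
  have stable_iff: "\<forall>\<kappa>>0. two_level_stable nrm \<sigma> T (?P \<kappa>) \<longleftrightarrow> \<kappa> \<le> 1 / (1 - \<sigma>)"
    if "\<sigma> < 1" "2 \<le> CARD('m)"
    using stable[OF that(1)] sharp[OF that] by blast
  have explicit: "\<forall>A \<in> dominant_family dominant T. \<forall>\<tau>>0.
      step_restriction (1 / (1 - \<sigma>)) T A \<tau> \<longrightarrow> a_priori_estimate nrm \<sigma> T A \<tau>" if "\<sigma> < 1"
    using step_restriction_estimate[OF assms(2) that] by blast
  show ?thesis
    using implicit implicit_stable stable[OF _ order.refl] explicit stable_iff estimate_iff' by blast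
qed

end
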